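(* If $G$ is a block graph with maximum degree $\Delta$ and clique number $\omega$, then $$\chi_2^f(G)=\max\Big\{\omega,\Big\lceil\frac{\Delta}{2}\Big\rceil+1\Big\}.$$
   Context: All graphs are finite and simple. A block of a graph $G$ is a maximal connected subgraph of $G$ that has no cut-vertices (of itself); $G$ is a block graph if every block of $G$ is a complete graph. The clique number is the largest cardinality of a clique. A $2$-frugal coloring of $G$ is a proper vertex coloring in which no color appears more than twice in the (open) neighborhood of any vertex; $\chi_2^f(G)$ is the minimum number of colors in a $2$-frugal coloring of $G$. *)

theory Defs
  imports Complex_Main "Graph_Theory.Graph_Theory"
begin

text \<open>
  Finite simple graphs are the library's \<^locale>\<open>graph\<close>s: finite symmetric digraphs
  without loops and parallel arcs, an undirected edge being a pair of opposite arcs.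
\<close>

definition neighborhood :: "('a, 'b) pre_digraph \<Rightarrow> 'a \<Rightarrow> 'a set" where
  "neighborhood G v = {u \<in> verts G. v \<rightarrow>\<^bsub>G\<^esub> u}"

text \<open>
  In a \<^locale>\<open>graph\<close> every edge at a vertex contributes exactly one outgoing arc, so
  \<^const>\<open>out_degree\<close> is the usual degree.
\<close>
definition max_degree :: "('a, 'b) pre_digraph \<Rightarrow> nat" where
  "max_degree G = Max (out_degree G ` verts G)"

definition clique :: "('a, 'b) pre_digraph \<Rightarrow> 'a set \<Rightarrow> bool" where
  "clique G K \<longleftrightarrow> K \<subseteq> verts G \<and> (\<forall>u\<in>K. \<forall>v\<in>K. u \<noteq> v \<longrightarrow> u \<rightarrow>\<^bsub>G\<^esub> v)"

definition clique_number :: "('a, 'b) pre_digraph \<Rightarrow> nat" where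
  "clique_number G = Max (card ` {K. clique G K})"

text \<open>
  A cut-vertex separates two other vertices of the same component. In particular, the
  one-vertex graph has no cut-vertex.
\<close>
definition cut_vertex :: "('a, 'b) pre_digraph \<Rightarrow> 'a \<Rightarrow> bool" where
  "cut_vertex G v \<longleftrightarrow> v \<in> verts G \<and>
     (\<exists>x y. x \<noteq> v \<and> y \<noteq> v \<and> x \<rightarrow>\<^sup>*\<^bsub>G\<^esub> y \<and> \<not> x \<rightarrow>\<^sup>*\<^bsub>pre_digraph.del_vert G v\<^esub> y)"

text \<open>
  A library subgraph of a \<^locale>\<open>graph\<close> may contain an arc without its reverse, so
  symmetry has to be required of the subgraphs as well.
\<close>
definition block :: "('a, 'b) pre_digraph \<Rightarrow> ('a, 'b) pre_digraph \<Rightarrow> bool" where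
  "block G B \<longleftrightarrow> pre_digraph.max_subgraph G
     (\<lambda>H. graph H \<and> Digraph_Component.connected H \<and> \<not> (\<exists>v. cut_vertex H v)) B"

definition block_graph :: "('a, 'b) pre_digraph \<Rightarrow> bool" where
  "block_graph G \<longleftrightarrow> graph G \<and> (\<forall>B. block G B \<longrightarrow> complete_digraph (card (verts B)) B)"

definition proper_coloring :: "('a, 'b) pre_digraph \<Rightarrow> ('a \<Rightarrow> 'c) \<Rightarrow> bool" where
  "proper_coloring G c \<longleftrightarrow> (\<forall>u\<in>verts G. \<forall>v\<in>verts G. u \<rightarrow>\<^bsub>G\<^esub> v \<longrightarrow> c u \<noteq> c v)"

definition frugal_coloring :: "nat \<Rightarrow> ('a, 'b) pre_digraph \<Rightarrow> ('a \<Rightarrow> 'c) \<Rightarrow> bool" where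
  "frugal_coloring t G c \<longleftrightarrow> proper_coloring G c \<and>
     (\<forall>v\<in>verts G. \<forall>i. card {u \<in> neighborhood G v. c u = i} \<le> t)"

definition frugal_chromatic_number :: "nat \<Rightarrow> ('a, 'b) pre_digraph \<Rightarrow> nat" where
  "frugal_chromatic_number t G =
     (LEAST k. \<exists>c :: 'a \<Rightarrow> nat. frugal_coloring t G c \<and> card (c ` verts G) = k)"

end

theory Submission
  imports Defs
begin

text \<open>
  Every vertex of degree $\Delta$ sees at least $\lceil \Delta/2 \rceil$ colors in a 2-frugal
  coloring and has itself yet another one, and a clique of size $\omega$ is rainbow; this is the
  lower bound (\<open>out_degree_le_if_frugal\<close>, \<open>clique_number_le_if_proper\<close>).

  For the upper bound, let $k \ge \omega$. The claim is that a block graph has a proper coloring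
  with $k$ colors that is \<^emph>\<open>balanced\<close>: at every vertex $v$, any two colors other than the one of
  $v$ occur in the neighborhood of $v$ equally often up to a difference of 1
  (\<open>ex_balanced_coloring\<close>). Unlike frugality, balance does not refer to the degrees, which is what
  makes it provable by induction. It implies frugality at the end: if some color occurred
  more than $t$ times around $v$, then each of the $k - 1$ colors other than the one of $v$
  would occur at least $t$ times, one of them more often, and $v$ would have more than
  $t(k-1)$ neighbors (\<open>frugal_if_balanced\<close>). With $t = 2$ and
  $k = \max\{\omega, \lceil \Delta/2 \rceil + 1\}$ this contradicts $\deg v \le \Delta$.

  The induction removes a leaf of the block tree: a set $C$ that is attached to the rest at a
  single vertex $v$, such that $C \cup \{v\}$ is a clique. It then colors $C$ with the $|C|$ colors
  that are least used around $v$; since $|C| \le k - 1$, this keeps $v$ balanced, and the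
  neighborhood of a vertex of $C$ is rainbow, hence balanced too
  (\<open>extend_balanced_coloring_clique\<close>). Neither the block tree nor any path has to be
  constructed to find $C$: among the nonempty vertex sets with at most one neighbor outside, take
  a smallest one. If removing a vertex disconnected $C \cup \{v\}$, then a part that avoids $v$
  would be a smaller such set (\<open>minimal_boundary_nonseparable\<close>). So $C \cup \{v\}$ lies in a block,
  and thus is a clique.
\<close>

section \<open>Nonseparable vertex sets\<close>

text \<open>
  Connectedness of the subgraph induced by \<open>A\<close>, expressed by cuts instead of walks, since a cut
  is what contradicts the minimality of a set with small boundary.
\<close>
definition linked :: "('a, 'b) pre_digraph \<Rightarrow> 'a set \<Rightarrow> bool" where
  "linked G A \<longleftrightarrow> (\<forall>D. D \<subseteq> A \<longrightarrow> D \<noteq> {} \<longrightarrow> D \<noteq> A \<longrightarrow> (\<exists>x\<in>D. \<exists>y\<in>A - D. x \<rightarrow>\<^bsub>G\<^esub> y))"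

definition nonseparable :: "('a, 'b) pre_digraph \<Rightarrow> 'a set \<Rightarrow> bool" where
  "nonseparable G A \<longleftrightarrow> linked G A \<and> (\<forall>z\<in>A. linked G (A - {z}))"

definition boundary :: "('a, 'b) pre_digraph \<Rightarrow> 'a set \<Rightarrow> 'a set \<Rightarrow> 'a set" where
  "boundary G W C = {u \<in> W - C. \<exists>w\<in>C. w \<rightarrow>\<^bsub>G\<^esub> u}"

text \<open>
  The vertices reachable from \<open>x\<close> form a set that no arc leaves. The digraph \<open>H\<close> is kept apart from
  \<open>G\<close> so that the lemma also covers an induced subgraph from which a vertex has been deleted.
\<close>
lemma linked_imp_reachable:
  assumes "linked G (verts H)" "x \<in> verts H" "y \<in> verts H"
    and arcs: "\<And>u v. u \<in> verts H \<Longrightarrow> v \<in> verts H \<Longrightarrow> u \<rightarrow>\<^bsub>G\<^esub> v \<Longrightarrow> u \<rightarrow>\<^bsub>H\<^esub> v"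
  shows "x \<rightarrow>\<^sup>*\<^bsub>H\<^esub> y"
proof (rule ccontr)
  assume "\<not> x \<rightarrow>\<^sup>*\<^bsub>H\<^esub> y"
  define D where "D = {z \<in> verts H. x \<rightarrow>\<^sup>*\<^bsub>H\<^esub> z}"
  have "x \<in> D" "y \<notin> D" "D \<subseteq> verts H"
    using assms(2,3) \<open>\<not> x \<rightarrow>\<^sup>*\<^bsub>H\<^esub> y\<close> by (auto simp: D_def reachable_def)
  then obtain u v where uv: "u \<in> D" "v \<in> verts H - D" "u \<rightarrow>\<^bsub>G\<^esub> v"
    using assms(1,3) unfolding linked_def by (metis empty_iff)
  then have "x \<rightarrow>\<^sup>*\<^bsub>H\<^esub> v"
    using arcs[of u v] by (auto simp: D_def reachable_def intro: rtrancl_on_into_rtrancl_on)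
  then show False using uv(2) by (simp add: D_def)
qed

lemma (in graph) graph_induce_subgraph:
  assumes "A \<subseteq> verts G"
  shows "graph (G \<restriction> A)"
proof -
  have "digraph (G \<restriction> A)"
    using assms by (intro digraph_subgraph induced_imp_subgraph induced_induce)
  then interpret H: digraph "G \<restriction> A" .
  have "symmetric (G \<restriction> A)"
    using graph_symmetric by (fastforce simp: symmetric_def arcs_ends_conv intro!: symI)
  then show ?thesis by unfold_locales
qed

lemma subgraph_eqI:
  assumes "subgraph H H'" "verts H = verts H'" "arcs H = arcs H'"
  shows "H = H'"
  using assms by (auto simp: subgraph_def compatible_def)

text \<open>
  Proper extension of a subgraph strictly increases the number of vertices and arcs together, which
  is bounded by that of \<open>G\<close>.
\<close>
lemma (in fin_digraph) ex_max_subgraph: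
  assumes "subgraph H G" "P H"
  obtains B where "max_subgraph P B" "subgraph H B"
proof -
  let ?Q = "\<lambda>B. subgraph B G \<and> P B \<and> subgraph H B"
  let ?m = "\<lambda>B. card (verts B) + card (arcs B)"
  have "?Q H" using assms by (auto simp: subgraph_def compatible_def)
  moreover have "\<forall>B. ?Q B \<longrightarrow> ?m B < Suc (?m G)"
    by (auto simp: subgraph_def less_Suc_eq_le intro!: add_mono card_mono)
  ultimately have "\<exists>B. ?Q B \<and> (\<forall>B'. ?Q B' \<longrightarrow> ?m B' \<le> ?m B)"
    by (rule ex_has_greatest_nat)
  then obtain B where B: "?Q B" "\<And>B'. ?Q B' \<Longrightarrow> ?m B' \<le> ?m B"
    by meson
  have "\<not> (subgraph B' G \<and> P B')" if "B' \<noteq> B" "subgraph B B'" for B'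
  proof
    assume *: "subgraph B' G \<and> P B'"
    then have fin: "finite (verts B')" "finite (arcs B')"
      using finite_subset[OF _ finite_verts] finite_subset[OF _ finite_arcs]
      by (auto simp: subgraph_def)
    have sub: "verts B \<subseteq> verts B'" "arcs B \<subseteq> arcs B'"
      using that by (auto simp: subgraph_def)
    have "?m B' \<le> ?m B"
      using * B that subgraph_trans by blast
    moreover have "card (verts B) \<le> card (verts B')" "card (arcs B) \<le> card (arcs B')"
      using sub fin by (auto intro: card_mono)
    ultimately have "card (verts B) = card (verts B')" "card (arcs B) = card (arcs B')"
      by linarith+
    then have "verts B = verts B'" "arcs B = arcs B'"
      using sub fin by (metis card_subset_eq)+
    then show False using that subgraph_eqI by metis
  qed
  then have "max_subgraph P B" using B(1) by (auto simp: max_subgraph_def)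
  then show ?thesis using that B(1) by blast
qed

text \<open>
  The subgraph induced by a nonseparable set is connected without cut-vertices, so it extends to a
  block.
\<close>
lemma (in graph) nonseparable_imp_clique:
  assumes "block_graph G" "A \<subseteq> verts G" "nonseparable G A"
  shows "clique G A"
proof (cases "A = {}")
  case True
  then show ?thesis by (simp add: clique_def)
next
  case False
  let ?H = "G \<restriction> A"
  interpret H: graph ?H using assms(2) by (rule graph_induce_subgraph)
  have adj: "u \<rightarrow>\<^bsub>?H\<^esub> v" if "u \<in> A" "v \<in> A" "u \<rightarrow>\<^bsub>G\<^esub> v" for u v
    using that by (auto simp: arcs_ends_conv)
  have "strongly_connected ?H"
    using False assms(3) adj
    by (intro strongly_connectedI linked_imp_reachable[where G = G]) (auto simp: nonseparable_def)
  then have conn: "Digraph_Component.connected ?H"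
    unfolding Digraph_Component.connected_def
    by (auto simp: strongly_connected_def intro: H.reachable_mk_symmetricI)
  have nocut: "\<not> cut_vertex ?H v" for v
  proof
    assume cut: "cut_vertex ?H v"
    let ?K = "pre_digraph.del_vert ?H v"
    obtain x y where xy: "x \<noteq> v" "y \<noteq> v" "x \<rightarrow>\<^sup>*\<^bsub>?H\<^esub> y" "\<not> x \<rightarrow>\<^sup>*\<^bsub>?K\<^esub> y"
      using cut by (auto simp: cut_vertex_def)
    have v: "v \<in> A" using cut by (simp add: cut_vertex_def)
    have "x \<in> A" "y \<in> A" using H.reachable_in_verts[OF xy(3)] by simp_all
    moreover have "u \<rightarrow>\<^bsub>?K\<^esub> w" if "u \<in> verts ?K" "w \<in> verts ?K" "u \<rightarrow>\<^bsub>G\<^esub> w" for u w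
      using that by (auto simp: arcs_ends_conv pre_digraph.del_vert_simps)
    ultimately have "x \<rightarrow>\<^sup>*\<^bsub>?K\<^esub> y"
      using assms(3) v xy(1,2)
      by (intro linked_imp_reachable[where G = G])
         (auto simp: nonseparable_def pre_digraph.del_vert_simps)
    then show False using xy(4) by simp
  qed
  obtain B where B: "block G B" "subgraph ?H B"
    unfolding block_def
  proof (rule ex_max_subgraph)
    show "subgraph ?H G" using assms(2) by (intro induced_imp_subgraph induced_induce)
    show "graph ?H \<and> Digraph_Component.connected ?H \<and> \<not> (\<exists>v. cut_vertex ?H v)"
      using H.graph_axioms conn nocut by blast
  qed
  have "complete_digraph (card (verts B)) B" using B(1) assms(1) by (simp add: block_graph_def)
  moreover have "subgraph B G" using B(1) by (simp add: block_def max_subgraph_def)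
  moreover have "A \<subseteq> verts B" using B(2) by (auto simp: subgraph_def)
  ultimately have "u \<rightarrow>\<^bsub>G\<^esub> v" if "u \<in> A" "v \<in> A" "u \<noteq> v" for u v
    using that by (intro adj_mono[where H = B]) (auto simp: complete_digraph_def)
  then show ?thesis using assms(2) by (simp add: clique_def)
qed

section \<open>A leaf of the block tree\<close>

text \<open>
  Suppose that deleting \<open>z\<close> (or nothing) splits \<open>C\<close> together with its boundary into two parts without
  arcs between them. The part that avoids \<open>v\<close> is contained in \<open>C\<close>, and its boundary is contained
  in \<open>{z}\<close>, which contradicts minimality unless that part is all of \<open>C\<close>; but then the other part
  consists of boundary vertices, which have neighbors in \<open>C\<close>.
\<close>
lemma (in graph) minimal_boundary_nonseparable:
  assumes C: "boundary G W C \<subseteq> {v}"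
    and min: "\<And>D z. D \<subset> C \<Longrightarrow> D \<noteq> {} \<Longrightarrow> \<not> boundary G W D \<subseteq> {z}"
  shows "nonseparable G (C \<union> boundary G W C)"
proof -
  let ?A = "C \<union> boundary G W C"
  \<comment> \<open>\<open>Z = {}\<close> gives connectedness, and \<open>Z = {z}\<close> that \<open>z\<close> is not a cut-vertex.\<close>
  have "linked G (?A - Z)" if Z: "Z \<subseteq> {z}" for Z z
    unfolding linked_def
  proof (intro allI impI, rule ccontr)
    let ?X = "?A - Z"
    fix D assume D: "D \<subseteq> ?X" "D \<noteq> {}" "D \<noteq> ?X"
      and "\<not> (\<exists>x\<in>D. \<exists>y\<in>?X - D. x \<rightarrow>\<^bsub>G\<^esub> y)"
    then have no_arc: "\<not> x \<rightarrow>\<^bsub>G\<^esub> y \<and> \<not> y \<rightarrow>\<^bsub>G\<^esub> x" if "x \<in> D" "y \<in> ?X - D" for x y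
      using that graph_symmetric by blast
    \<comment> \<open>The side of the cut that avoids \<open>v\<close>.\<close>
    obtain D' where D': "D' \<subseteq> ?X" "D' \<noteq> {}" "D' \<noteq> ?X" "v \<notin> D'"
      and no_arc': "\<And>x y. x \<in> D' \<Longrightarrow> y \<in> ?X - D' \<Longrightarrow> \<not> x \<rightarrow>\<^bsub>G\<^esub> y"
    proof (cases "v \<in> D")
      case True
      show ?thesis
      proof (rule that)
        show "?X - D \<subseteq> ?X" by blast
        show "?X - D \<noteq> {}" using D by blast
        show "?X - D \<noteq> ?X" using D by blast
        show "v \<notin> ?X - D" using True by blast
        show "\<not> x \<rightarrow>\<^bsub>G\<^esub> y" if "x \<in> ?X - D" "y \<in> ?X - (?X - D)" for x y
          using no_arc[of y x] that by blast
      qed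
    next
      case False
      then show ?thesis using that[of D] D no_arc by blast
    qed
    have "D' \<subseteq> C" using D'(1,4) C by blast
    moreover have "D' \<noteq> C"
    proof
      assume "D' = C"
      then obtain u where u: "u \<in> ?X - D'" "u \<in> boundary G W C" using D'(1,3) by blast
      then obtain w where "w \<in> C" "w \<rightarrow>\<^bsub>G\<^esub> u" by (auto simp: boundary_def)
      then show False using no_arc' u(1) \<open>D' = C\<close> by blast
    qed
    moreover have "boundary G W D' \<subseteq> {z}"
    proof
      fix u assume "u \<in> boundary G W D'"
      then obtain w where w: "w \<in> D'" "w \<rightarrow>\<^bsub>G\<^esub> u" "u \<in> W" "u \<notin> D'" by (auto simp: boundary_def)
      then have "u \<in> ?A" using \<open>D' \<subseteq> C\<close> by (auto simp: boundary_def)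
      then show "u \<in> {z}" using no_arc' w Z by blast
    qed
    ultimately show False using min D'(2) by blast
  qed
  from this[of "{}"] this[of "{z}" z for z] show ?thesis
    by (simp add: nonseparable_def)
qed

text \<open>
  The set \<open>C\<close> is a smallest nonempty set with at most one boundary vertex; \<open>W\<close> itself, whose boundary
  is empty, shows that such sets exist. A smallest set with empty boundary is a single vertex:
  if one of its vertices \<open>w\<close> is dropped, the others have at most \<open>w\<close> in their boundary.
\<close>
lemma (in graph) ex_pendant_clique:
  assumes "block_graph G" "W \<subseteq> verts G" "W \<noteq> {}"
  obtains C v where "C \<subseteq> W" "C \<noteq> {}" "boundary G W C = {v}" "clique G (insert v C)"
    | w where "w \<in> W" "boundary G W {w} = {}"
proof -
  let ?Q = "\<lambda>C. C \<subseteq> W \<and> C \<noteq> {} \<and> (\<exists>z. boundary G W C \<subseteq> {z})"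
  have fin: "finite W" using assms(2) finite_subset[OF _ finite_verts] by auto
  have "?Q W" using assms(3) by (auto simp: boundary_def)
  then have "\<exists>C. ?Q C \<and> (\<forall>D. ?Q D \<longrightarrow> card C \<le> card D)"
    by (rule ex_has_least_nat)
  then obtain C where C: "?Q C" "\<And>D. ?Q D \<Longrightarrow> card C \<le> card D" by meson
  then obtain v where v: "boundary G W C \<subseteq> {v}" by blast
  have min: "\<not> boundary G W D \<subseteq> {z}" if "D \<subset> C" "D \<noteq> {}" for D z
  proof
    assume "boundary G W D \<subseteq> {z}"
    then have "card C \<le> card D" using C that by blast
    moreover have "card D < card C"
      using that C(1) fin by (meson finite_subset psubset_card_mono)
    ultimately show False by simp
  qed
  show ?thesis
  proof (cases "boundary G W C = {}")
    case True
    obtain w where w: "w \<in> C" using C(1) by blast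
    have "boundary G W (C - {w}) \<subseteq> {w}" using True by (auto simp: boundary_def)
    then have "C = {w}" using min[of "C - {w}" w] w by blast
    then show ?thesis using that(2)[of w] True C(1) by simp
  next
    case False
    then have bd: "boundary G W C = {v}" using v by blast
    then have "nonseparable G (insert v C)"
      using minimal_boundary_nonseparable[OF v min] by simp
    moreover have "insert v C \<subseteq> verts G" using bd C(1) assms(2) by (auto simp: boundary_def)
    ultimately have "clique G (insert v C)" using nonseparable_imp_clique assms(1) by blast
    then show ?thesis using that(1) bd C(1) by blast
  qed
qed

section \<open>Balanced colorings\<close>

lemma ex_least_valued_subset:
  fixes n :: "'a \<Rightarrow> nat"
  assumes "finite I" "m \<le> card I"
  obtains J where "J \<subseteq> I" "card J = m" "\<And>i j. i \<in> J \<Longrightarrow> j \<in> I - J \<Longrightarrow> n i \<le> n j"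
proof -
  have "\<exists>J. J \<subseteq> I \<and> card J = m \<and> (\<forall>i\<in>J. \<forall>j\<in>I - J. n i \<le> n j)"
    using assms(2)
  proof (induction m)
    case 0
    show ?case by (rule exI[of _ "{}"]) simp
  next
    case (Suc m)
    then obtain J where J: "J \<subseteq> I" "card J = m" "\<forall>i\<in>J. \<forall>j\<in>I - J. n i \<le> n j" by auto
    have "I - J \<noteq> {}" using J(1,2) Suc.prems by auto
    then obtain a where a: "a \<in> I - J" "\<And>j. j \<in> I - J \<Longrightarrow> n a \<le> n j"
      using ex_has_least_nat[of "\<lambda>i. i \<in> I - J" _ n] by blast
    have "finite J" using J(1) assms(1) finite_subset by blast
    then have "card (insert a J) = Suc m" using J(2) a(1) by simp
    then show ?case using J a by (intro exI[of _ "insert a J"]) auto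
  qed
  then show ?thesis using that by blast
qed

definition color_degree :: "('a, 'b) pre_digraph \<Rightarrow> 'a set \<Rightarrow> ('a \<Rightarrow> nat) \<Rightarrow> 'a \<Rightarrow> nat \<Rightarrow> nat" where
  "color_degree G W c v i = card {u \<in> neighborhood G v \<inter> W. c u = i}"

text \<open>
  The color of \<open>v\<close> is exempt from the comparison at \<open>v\<close>: it cannot occur in the neighborhood of \<open>v\<close>,
  while each of the other colors may occur several times.
\<close>
definition balanced_coloring :: "nat \<Rightarrow> ('a, 'b) pre_digraph \<Rightarrow> 'a set \<Rightarrow> ('a \<Rightarrow> nat) \<Rightarrow> bool" where
  "balanced_coloring k G W c \<longleftrightarrow> c ` W \<subseteq> {..<k} \<and>
     (\<forall>u\<in>W. \<forall>v\<in>W. u \<rightarrow>\<^bsub>G\<^esub> v \<longrightarrow> c u \<noteq> c v) \<and>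
     (\<forall>v\<in>W. \<forall>i\<in>{..<k} - {c v}. \<forall>j\<in>{..<k} - {c v}.
        color_degree G W c v i \<le> color_degree G W c v j + 1)"

lemma color_degree_le_1:
  assumes "inj_on c (neighborhood G v \<inter> W)"
  shows "color_degree G W c v i \<le> 1"
proof -
  have "{u \<in> neighborhood G v \<inter> W. c u = i} \<subseteq> {x}" if "x \<in> neighborhood G v \<inter> W" "c x = i" for x
    using assms that by (auto dest: inj_onD)
  then have "\<exists>x. {u \<in> neighborhood G v \<inter> W. c u = i} \<subseteq> {x}" by blast
  then show ?thesis unfolding color_degree_def
    by (metis One_nat_def card.empty card_insert_disjoint card_mono empty_iff finite.emptyI finite.insertI)
qed

lemma (in graph) extend_balanced_coloring_isolated:
  assumes "w \<in> W" "boundary G W {w} = {}" "k > 0"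
    and c: "balanced_coloring k G (W - {w}) c"
  shows "balanced_coloring k G W (c(w := 0))"
proof -
  have iso: "\<not> w \<rightarrow>\<^bsub>G\<^esub> u \<and> \<not> u \<rightarrow>\<^bsub>G\<^esub> w" if "u \<in> W" for u
    using assms(2) that graph_symmetric[of u w] adj_not_same[of w] by (auto simp: boundary_def)
  have "color_degree G W (c(w := 0)) v i = color_degree G (W - {w}) c v i" if "v \<in> W" for v i
    using iso[OF that] unfolding color_degree_def
    by (intro arg_cong[where f = card]) (auto simp: neighborhood_def)
  moreover have "color_degree G (W - {w}) c w i = 0" for i
    using iso unfolding color_degree_def by (auto simp: neighborhood_def)
  ultimately show ?thesis
    using c iso assms(3) unfolding balanced_coloring_def by (auto split: if_splits)
qed

text \<open>
  Only the neighborhoods of \<open>v\<close> and of the vertices of \<open>C\<close> meet \<open>C\<close>. At a vertex of \<open>C\<close> all neighbors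
  belong to the rainbow clique \<open>insert v C\<close>. At \<open>v\<close>, a set \<open>J\<close> of least used colors gains one
  occurrence each: the difference between a color in \<open>J\<close> and one outside is 0 or 1 in favor of the
  latter before this, so it is at most 1 in either direction afterwards.
\<close>
lemma (in graph) extend_balanced_coloring_clique:
  assumes W: "W \<subseteq> verts G" "C \<subseteq> W"
    and bd: "boundary G W C = {v}"
    and clq: "clique G (insert v C)" and k: "card (insert v C) \<le> k"
    and c: "balanced_coloring k G (W - C) c"
  obtains c' where "balanced_coloring k G W c'"
proof -
  have fin: "finite W" "finite C" using W finite_subset finite_verts by metis+
  have v: "v \<in> W - C" using bd by (auto simp: boundary_def)
  define n where "n = color_degree G (W - C) c v"
  define I where "I = {..<k} - {c v}"
  have "c v < k" using c v by (auto simp: balanced_coloring_def)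
  then have "card C \<le> card I" using k v fin by (simp add: I_def)
  then obtain J where J: "J \<subseteq> I" "card J = card C" "\<And>i j. i \<in> J \<Longrightarrow> j \<in> I - J \<Longrightarrow> n i \<le> n j"
    using ex_least_valued_subset[of I] by (auto simp: I_def)
  have "finite J" using J(1) by (auto simp: I_def intro: finite_subset)
  then obtain f where f: "bij_betw f C J" using J(2) fin by (metis finite_same_card_bij)
  define c' where "c' = (\<lambda>u. if u \<in> C then f u else c u)"
  have c'_out: "c' u = c u" if "u \<notin> C" for u using that by (simp add: c'_def)
  have c'_in: "c' u \<in> J" if "u \<in> C" for u using that f by (auto simp: c'_def bij_betw_def)
  have inj: "inj_on c' (insert v C)"
  proof -
    have "inj_on c' C" using f by (auto simp: c'_def bij_betw_def inj_on_def)
    moreover have "c' v \<notin> J" using J(1) c'_out[of v] v by (auto simp: I_def)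
    then have "c' v \<notin> c' ` C" using c'_in by force
    ultimately show ?thesis using v by simp
  qed
  have nbr_C: "neighborhood G w \<inter> W \<subseteq> insert v C" if "w \<in> C" for w
    using bd that by (auto simp: boundary_def neighborhood_def)
  have sym: "x \<rightarrow>\<^bsub>G\<^esub> y \<Longrightarrow> y \<rightarrow>\<^bsub>G\<^esub> x" for x y by (rule graph_symmetric)
  have nbr_v: "C \<subseteq> neighborhood G v"
    using clq v W unfolding clique_def neighborhood_def by auto
  have proper: "c' x \<noteq> c' y" if "x \<in> W" "y \<in> W" "x \<rightarrow>\<^bsub>G\<^esub> y" for x y
  proof (cases "x \<in> C \<or> y \<in> C")
    case True
    then have "x \<in> insert v C" "y \<in> insert v C"
      using nbr_C[of x] nbr_C[of y] that sym[OF that(3)] W by (auto simp: neighborhood_def)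
    moreover have "x \<noteq> y" using that(3) adj_not_same by blast
    ultimately show ?thesis using inj_on_contraD[OF inj] by blast
  next
    case False
    then show ?thesis using that c by (auto simp: balanced_coloring_def c'_out)
  qed
  have deg_v: "color_degree G W c' v i = n i + (if i \<in> J then 1 else 0)" for i
  proof -
    have "{u \<in> neighborhood G v \<inter> W. c' u = i}
        = {u \<in> neighborhood G v \<inter> (W - C). c u = i} \<union> {u \<in> C. f u = i}"
      using nbr_v W by (auto simp: c'_def)
    moreover have "card {u \<in> C. f u = i} = (if i \<in> J then 1 else 0)"
    proof (cases "i \<in> J")
      case True
      then obtain u where "u \<in> C" "f u = i" using f by (auto simp: bij_betw_def)
      then have "{u \<in> C. f u = i} = {u}" using f by (auto simp: bij_betw_def inj_on_def)
      then show ?thesis using True by simp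
    next
      case False
      then have "{u \<in> C. f u = i} = {}" using f by (auto simp: bij_betw_def)
      then show ?thesis using False by (simp only: card.empty if_False)
    qed
    moreover have "card ({u \<in> neighborhood G v \<inter> (W - C). c u = i} \<union> {u \<in> C. f u = i})
        = card {u \<in> neighborhood G v \<inter> (W - C). c u = i} + card {u \<in> C. f u = i}"
      using fin by (intro card_Un_disjoint) auto
    ultimately show ?thesis by (simp only: n_def color_degree_def)
  qed
  have bal: "color_degree G W c' x i \<le> color_degree G W c' x j + 1"
    if x: "x \<in> W" and ij: "i \<in> {..<k} - {c' x}" "j \<in> {..<k} - {c' x}" for x i j
  proof -
    consider "x \<in> C" | "x = v" | "x \<notin> insert v C" by blast
    then show ?thesis
    proof cases
      case 1
      then have "color_degree G W c' x i \<le> 1"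
        by (intro color_degree_le_1 inj_on_subset[OF inj nbr_C])
      then show ?thesis by simp
    next
      case 2
      then have I: "i \<in> I" "j \<in> I" using ij c'_out v by (auto simp: I_def)
      then have "n i \<le> n j + 1"
        using c v unfolding balanced_coloring_def n_def I_def by blast
      then show ?thesis using I J(3)[of i j] by (auto simp: 2 deg_v)
    next
      case 3
      have "\<not> x \<rightarrow>\<^bsub>G\<^esub> w" if "w \<in> C" for w
      proof
        assume "x \<rightarrow>\<^bsub>G\<^esub> w"
        then have "x \<in> neighborhood G w \<inter> W" using sym x W(1) by (auto simp: neighborhood_def)
        then show False using nbr_C[OF that] 3 by blast
      qed
      then have "neighborhood G x \<inter> C = {}" by (auto simp: neighborhood_def)
      then have "color_degree G W c' x l = color_degree G (W - C) c x l" for l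
        unfolding color_degree_def
        by (intro arg_cong[where f = card]) (auto simp: c'_def)
      moreover have "x \<in> W - C" "i \<in> {..<k} - {c x}" "j \<in> {..<k} - {c x}"
        using x ij 3 c'_out[of x] by auto
      ultimately show ?thesis using c unfolding balanced_coloring_def by metis
    qed
  qed
  have "c' ` W \<subseteq> {..<k}"
    using c c'_in J(1) by (auto simp: c'_def balanced_coloring_def I_def)
  then have "balanced_coloring k G W c'"
    unfolding balanced_coloring_def using proper bal by simp
  then show ?thesis by (rule that)
qed

section \<open>Block graphs have balanced colorings\<close>

lemma (in graph) card_clique_le_clique_number:
  assumes "clique G K"
  shows "card K \<le> clique_number G"
proof -
  have "{K. clique G K} \<subseteq> Pow (verts G)" by (auto simp: clique_def)
  then have "finite {K. clique G K}" by (rule finite_subset) simp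
  then show ?thesis using assms unfolding clique_number_def by (auto intro: Max_ge)
qed

lemma (in graph) ex_balanced_coloring:
  assumes "block_graph G" "clique_number G \<le> k" "k > 0" "W \<subseteq> verts G"
  shows "\<exists>c. balanced_coloring k G W c"
  using assms(4)
proof (induction "card W" arbitrary: W rule: less_induct)
  case less
  have fin: "finite W" using less.prems finite_subset finite_verts by metis
  show ?case
  proof (cases "W = {}")
    case True
    then show ?thesis by (auto simp: balanced_coloring_def)
  next
    case False
    have IH: "\<exists>c. balanced_coloring k G (W - C) c" if "C \<subseteq> W" "C \<noteq> {}" for C
      using that fin less.prems by (intro less.hyps psubset_card_mono) auto
    from assms(1) less.prems False show ?thesis
    proof (cases rule: ex_pendant_clique)
      case (1 C v)
      then show ?thesis
        using IH[of C] extend_balanced_coloring_clique[of W C v k] less.prems assms(2)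
          card_clique_le_clique_number[of "insert v C"] by (meson order_trans)
    next
      case (2 w)
      then show ?thesis
        using IH[of "{w}"] extend_balanced_coloring_isolated[of w W k] assms(3) by blast
    qed
  qed
qed

section \<open>Frugal colorings and degrees\<close>

lemma (in graph) card_neighborhood:
  "card (neighborhood G v) = out_degree G v"
proof -
  have "neighborhood G v = head G ` out_arcs G v"
    by (auto simp: neighborhood_def arcs_ends_conv out_arcs_def)
  moreover have "inj_on (head G) (out_arcs G v)"
    using no_multi_arcs by (auto simp: inj_on_def out_arcs_def arc_to_ends_def)
  ultimately show ?thesis by (simp add: out_degree_def card_image)
qed

lemma (in graph) finite_neighborhood: "finite (neighborhood G v)"
  by (simp add: neighborhood_def)

lemma (in graph) out_degree_eq_sum_color_classes:
  assumes "finite S" "c ` neighborhood G v \<subseteq> S"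
  shows "out_degree G v = (\<Sum>i\<in>S. card {u \<in> neighborhood G v. c u = i})"
  using sum.group[OF finite_neighborhood assms, of "\<lambda>_. 1 :: nat"] by (simp add: card_neighborhood)

text \<open>
  If one color occurred more than \<open>t\<close> times around \<open>v\<close>, then by balance every one of the \<open>k - 1\<close>
  colors that differ from the color of \<open>v\<close> would occur at least \<open>t\<close> times, which makes more than
  \<open>t * (k - 1)\<close> neighbors in total.
\<close>
lemma (in graph) frugal_if_balanced:
  assumes c: "balanced_coloring k G (verts G) c"
    and deg: "\<And>v. v \<in> verts G \<Longrightarrow> out_degree G v \<le> t * (k - 1)"
  shows "frugal_coloring t G c"
  unfolding frugal_coloring_def
proof (intro conjI ballI allI)
  show proper: "proper_coloring G c"
    using c by (simp add: proper_coloring_def balanced_coloring_def)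
  fix v i assume v: "v \<in> verts G"
  let ?n = "\<lambda>i. card {u \<in> neighborhood G v. c u = i}"
  let ?I = "{..<k} - {c v}"
  have sub: "c ` neighborhood G v \<subseteq> ?I"
  proof
    fix j assume "j \<in> c ` neighborhood G v"
    then obtain u where u: "u \<in> verts G" "v \<rightarrow>\<^bsub>G\<^esub> u" "j = c u"
      by (auto simp: neighborhood_def)
    then have "c u \<noteq> c v" using proper v unfolding proper_coloring_def by metis
    moreover have "c u < k" using c u(1) by (auto simp: balanced_coloring_def)
    ultimately show "j \<in> ?I" using u(3) by simp
  qed
  have bal: "?n i \<le> ?n j + 1" if "i \<in> ?I" "j \<in> ?I" for i j
  proof -
    have "neighborhood G v \<inter> verts G = neighborhood G v" by (auto simp: neighborhood_def)
    moreover have "color_degree G (verts G) c v i \<le> color_degree G (verts G) c v j + 1"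
      using c v that unfolding balanced_coloring_def by blast
    ultimately show ?thesis by (simp add: color_degree_def)
  qed
  show "?n i \<le> t"
  proof (rule ccontr)
    assume "\<not> ?n i \<le> t"
    then have big: "t + 1 \<le> ?n i" by simp
    then have "?n i \<noteq> 0" by simp
    then obtain u where "u \<in> neighborhood G v" "c u = i"
      by (metis (mono_tags, lifting) card.empty empty_Collect_eq)
    then have i: "i \<in> ?I" using sub by blast
    have "t * (k - 1) = (\<Sum>j\<in>?I. t)"
      using c v by (auto simp: balanced_coloring_def)
    also have "\<dots> < (\<Sum>j\<in>?I. ?n j)"
    proof (rule sum_strict_mono_ex1)
      show "\<forall>j\<in>?I. t \<le> ?n j" using bal[OF i] big by fastforce
      show "\<exists>j\<in>?I. t < ?n j" using i big by (intro bexI[of _ i]) simp_all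
    qed simp
    also have "\<dots> = out_degree G v"
      using out_degree_eq_sum_color_classes[OF _ sub] by simp
    finally show False using deg[OF v] by simp
  qed
qed

text \<open>
  The neighbors of \<open>v\<close> use only the colors other than the one of \<open>v\<close>, each at most \<open>t\<close> times.
\<close>
lemma (in graph) out_degree_le_if_frugal:
  assumes c: "frugal_coloring t G c" and v: "v \<in> verts G"
  shows "out_degree G v \<le> t * (card (c ` verts G) - 1)"
proof -
  let ?S = "c ` verts G - {c v}"
  have "c ` neighborhood G v \<subseteq> ?S"
    using c v by (force simp: neighborhood_def frugal_coloring_def proper_coloring_def)
  then have "out_degree G v = (\<Sum>i\<in>?S. card {u \<in> neighborhood G v. c u = i})"
    by (intro out_degree_eq_sum_color_classes) auto
  also have "\<dots> \<le> card ?S * t"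
    using c v sum_bounded_above[of ?S "\<lambda>i. card {u \<in> neighborhood G v. c u = i}" t]
    by (simp add: frugal_coloring_def)
  also have "card ?S = card (c ` verts G) - 1" using v by simp
  finally show ?thesis by (simp add: mult.commute)
qed

lemma (in graph) clique_number_le_if_proper:
  assumes c: "proper_coloring G c"
  shows "clique_number G \<le> card (c ` verts G)"
proof -
  have "card K \<le> card (c ` verts G)" if K: "clique G K" for K
  proof -
    have "inj_on c K" using c K by (force simp: inj_on_def clique_def proper_coloring_def)
    then have "card K = card (c ` K)" by (simp add: card_image)
    also have "\<dots> \<le> card (c ` verts G)" using K by (intro card_mono) (auto simp: clique_def)
    finally show ?thesis .
  qed
  moreover have "finite {K. clique G K}"
    by (rule finite_subset[of _ "Pow (verts G)"]) (auto simp: clique_def)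
  moreover have "clique G {}" by (simp add: clique_def)
  ultimately show ?thesis unfolding clique_number_def by (subst Max_le_iff) auto
qed

section \<open>The 2-frugal chromatic number of a block graph\<close>

theorem theorem6p1:
  fixes G :: "('a, 'b) pre_digraph" and \<Delta> \<omega> :: nat
  assumes "block_graph G"
    and "verts G \<noteq> {}"
    and "max_degree G = \<Delta>"
    and "clique_number G = \<omega>"
  shows "frugal_chromatic_number 2 G = max \<omega> (nat \<lceil>real \<Delta> / 2\<rceil> + 1)"
proof -
  interpret graph G using assms(1) by (simp add: block_graph_def)
  define k where "k = max \<omega> (nat \<lceil>real \<Delta> / 2\<rceil> + 1)"
  have ceil: "nat \<lceil>real \<Delta> / 2\<rceil> \<le> m \<longleftrightarrow> \<Delta> \<le> 2 * m" for m
    by (simp add: nat_le_iff ceiling_le_iff) linarith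
  have deg: "out_degree G v \<le> \<Delta>" if "v \<in> verts G" for v
    using that assms(3) by (auto simp: max_degree_def)
  obtain v where v: "v \<in> verts G" "out_degree G v = \<Delta>"
    using Max_in[of "out_degree G ` verts G"] assms(2,3) unfolding max_degree_def by fastforce
  have lower: "k \<le> card (c ` verts G)" if c: "frugal_coloring 2 G c" for c :: "'a \<Rightarrow> nat"
  proof -
    have "card (c ` verts G) \<noteq> 0" using assms(2) by simp
    then have "nat \<lceil>real \<Delta> / 2\<rceil> + 1 \<le> card (c ` verts G)"
      using out_degree_le_if_frugal[OF c v(1)] v(2) ceil[of "card (c ` verts G) - 1"] by linarith
    moreover have "\<omega> \<le> card (c ` verts G)"
      using clique_number_le_if_proper[of c] c assms(4) by (simp add: frugal_coloring_def)
    ultimately show ?thesis by (simp add: k_def)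
  qed
  have "\<omega> \<le> k" "k > 0" by (auto simp: k_def)
  then obtain c where c: "balanced_coloring k G (verts G) c"
    using ex_balanced_coloring[of k "verts G"] assms(1,4) by auto
  have "nat \<lceil>real \<Delta> / 2\<rceil> \<le> k - 1" unfolding k_def by linarith
  then have "\<Delta> \<le> 2 * (k - 1)" using ceil by blast
  then have frugal: "frugal_coloring 2 G c"
    using frugal_if_balanced[OF c] deg order_trans by blast
  have "c ` verts G \<subseteq> {..<k}" using c by (simp add: balanced_coloring_def)
  then have "card (c ` verts G) \<le> k" using card_mono[of "{..<k}"] by fastforce
  then have "card (c ` verts G) = k" using lower[OF frugal] by simp
  then show ?thesis
    unfolding frugal_chromatic_number_def k_def[symmetric]
    using frugal lower by (intro Least_equality) auto
qed

end
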